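(* Let $S$ be the facial monoid with generators $s_i$, $i\in\mathbf{N}$, and let $S_n$ be the sub-monoid of $S$ generated by $s_1,\ldots,s_n$. The canonical monoid homomorphism $$\bigl\langle s_i,\ 1\leq i\leq n : s_js_i=s_is_{j+1}\ \forall\, i\leq j\leq n-1\bigr\rangle\longrightarrow S_n$$ (sending each generator $s_i$ to $s_i\in S_n$) is injective.
   Context: $\mathbf{N}=\{1,2,\ldots\}$. The facial monoid is the monoid given by the monoid presentation $S=\langle s_i\ (i\in\mathbf{N}) : s_js_i=s_is_{j+1}\ \forall\,1\leq i\leq j\rangle$. The left hand side in the claim is also a monoid presentation, with the $n$ generators $s_1,\ldots,s_n$ and relations indexed by $1\leq i\leq j\leq n-1$. *)

theory Defs
  imports "HOL-Algebra.Group" "HOL.Hull"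
begin

text \<open>The free monoid on a set \<open>X\<close> is \<open>lists X\<close> under concatenation. A presentation consists of
  a generating set \<open>X\<close> and a set \<open>R\<close> of pairs of words over \<open>X\<close>; the pairs \<open>(u, v) \<in> R\<close> stand
  for the relations \<open>u = v\<close>.\<close>

inductive_set pres_cong :: "'a set \<Rightarrow> ('a list \<times> 'a list) set \<Rightarrow> ('a list \<times> 'a list) set"
  for X :: "'a set" and R :: "('a list \<times> 'a list) set" where
  rel: "(u, v) \<in> R \<Longrightarrow> u \<in> lists X \<Longrightarrow> v \<in> lists X \<Longrightarrow> (u, v) \<in> pres_cong X R"
| refl: "u \<in> lists X \<Longrightarrow> (u, u) \<in> pres_cong X R"
| sym: "(u, v) \<in> pres_cong X R \<Longrightarrow> (v, u) \<in> pres_cong X R"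
| trans: "(u, v) \<in> pres_cong X R \<Longrightarrow> (v, w) \<in> pres_cong X R \<Longrightarrow> (u, w) \<in> pres_cong X R"
| append: "(u, v) \<in> pres_cong X R \<Longrightarrow> (u', v') \<in> pres_cong X R \<Longrightarrow>
    (u @ u', v @ v') \<in> pres_cong X R"

definition presented_monoid :: "'a set \<Rightarrow> ('a list \<times> 'a list) set \<Rightarrow> 'a list set monoid" where
  "presented_monoid X R =
    \<lparr>carrier = lists X // pres_cong X R,
     mult = (\<lambda>A B. \<Union>u\<in>A. \<Union>v\<in>B. pres_cong X R `` {u @ v}),
     one = pres_cong X R `` {[]}\<rparr>"

definition pres_gen :: "'a set \<Rightarrow> ('a list \<times> 'a list) set \<Rightarrow> 'a \<Rightarrow> 'a list set" where
  "pres_gen X R x = pres_cong X R `` {[x]}"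

text \<open>The map on congruence classes induced by an assignment \<open>f\<close> of elements of \<open>M\<close> to the
  generators. It is meaningful when \<open>f\<close> respects the relations: then all words in a class \<open>A\<close>
  have the same value in \<open>M\<close>.\<close>

definition pres_lift :: "('b, 'c) monoid_scheme \<Rightarrow> ('a \<Rightarrow> 'b) \<Rightarrow> 'a list set \<Rightarrow> 'b" where
  "pres_lift M f A = the_elem ((\<lambda>w. foldr (\<otimes>\<^bsub>M\<^esub>) (map f w) \<one>\<^bsub>M\<^esub>) ` A)"

text \<open>The library's \<open>hom\<close> does not require that the unit is preserved.\<close>

definition unital_hom ::
  "('a, 'c) monoid_scheme \<Rightarrow> ('b, 'd) monoid_scheme \<Rightarrow> ('a \<Rightarrow> 'b) set" where
  "unital_hom M N = {h \<in> hom M N. h \<one>\<^bsub>M\<^esub> = \<one>\<^bsub>N\<^esub>}"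

text \<open>The generator \<open>s\<^sub>i\<close> is the letter \<open>i :: nat\<close>; generators are numbered from 1.\<close>

definition facial_rels :: "(nat list \<times> nat list) set" where
  "facial_rels = {([j, i], [i, j + 1]) | i j. 1 \<le> i \<and> i \<le> j}"

definition facial_monoid :: "nat list set monoid" where
  "facial_monoid = presented_monoid {1..} facial_rels"

definition facial_gen :: "nat \<Rightarrow> nat list set" where
  "facial_gen i = pres_gen {1..} facial_rels i"

definition facial_submonoid :: "nat \<Rightarrow> nat list set monoid" where
  "facial_submonoid n = facial_monoid
    \<lparr>carrier := (\<lambda>H. submonoid H facial_monoid) hull (facial_gen ` {1..n})\<rparr>"

definition trunc_rels :: "nat \<Rightarrow> (nat list \<times> nat list) set" where
  "trunc_rels n = {([j, i], [i, j + 1]) | i j. 1 \<le> i \<and> i \<le> j \<and> j \<le> n - 1}"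

definition trunc_monoid :: "nat \<Rightarrow> nat list set monoid" where
  "trunc_monoid n = presented_monoid {1..n} (trunc_rels n)"

definition trunc_gen :: "nat \<Rightarrow> nat \<Rightarrow> nat list set" where
  "trunc_gen n i = pres_gen {1..n} (trunc_rels n) i"

definition canonical_hom :: "nat \<Rightarrow> nat list set \<Rightarrow> nat list set" where
  "canonical_hom n = pres_lift (facial_submonoid n) facial_gen"

end

theory Submission
  imports Defs
begin

text \<open>Read from right to left, the relations rewrite \<open>s\<^sub>i s\<^sub>k\<close> with \<open>i < k\<close> to
  \<open>s\<^bsub>k-1\<^esub> s\<^sub>i\<close>. This never increases the largest index, so every word in
  \<open>s\<^sub>1, \<dots>, s\<^sub>n\<close> is brought to weakly decreasing form by the truncated relations alone.
  Left multiplication followed by this rewriting is an action of the whole facial monoid on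
  words, hence the normal form depends only on the element of \<open>S\<close>. Two words in
  \<open>s\<^sub>1, \<dots>, s\<^sub>n\<close> that agree in \<open>S\<close> thus have the same normal form, and each is equal to it
  modulo the truncated relations.\<close>

section \<open>Congruences and monoids of presentations\<close>

lemma pres_cong_in_lists:
  "(u, v) \<in> pres_cong X R \<Longrightarrow> u \<in> lists X \<and> v \<in> lists X"
  by (induction rule: pres_cong.induct) auto

lemma equiv_pres_cong: "equiv (lists X) (pres_cong X R)"
proof (rule equivI)
  show "pres_cong X R \<subseteq> lists X \<times> lists X"
    using pres_cong_in_lists by fast
  show "refl_on (lists X) (pres_cong X R)"
    by (rule refl_onI) (rule pres_cong.refl)
  show "sym (pres_cong X R)"
    by (rule symI) (rule pres_cong.sym)
  show "trans (pres_cong X R)"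
    by (rule transI) (rule pres_cong.trans)
qed

lemma pres_class_eq_iff:
  assumes "u \<in> lists X" "v \<in> lists X"
  shows "pres_cong X R `` {u} = pres_cong X R `` {v} \<longleftrightarrow> (u, v) \<in> pres_cong X R"
  using eq_equiv_class_iff[OF equiv_pres_cong assms] .

lemma pres_cong_mono:
  assumes "X \<subseteq> Y" "R \<subseteq> Q"
  shows "pres_cong X R \<subseteq> pres_cong Y Q"
proof (rule subrelI)
  fix u v
  assume "(u, v) \<in> pres_cong X R"
  then show "(u, v) \<in> pres_cong Y Q"
  proof induction
    case (rel u v)
    then show ?case
      using assms lists_mono[OF assms(1)] by (intro pres_cong.rel) auto
  next
    case (refl u)
    then show ?case
      using lists_mono[OF assms(1)] by (intro pres_cong.refl) auto
  qed (auto intro: pres_cong.sym pres_cong.trans pres_cong.append)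
qed

lemma pres_cong_Cons:
  assumes "(u, v) \<in> pres_cong X R" "x \<in> X"
  shows "(x # u, x # v) \<in> pres_cong X R"
  using pres_cong.append[OF pres_cong.refl[of "[x]"] assms(1)] assms(2) by simp

text \<open>Compatibility of the congruence with concatenation makes all sets in the double union of
  \<open>presented_monoid\<close> equal, and reflexivity makes the union nonempty.\<close>

lemma mult_presented_monoid:
  assumes "u \<in> lists X" "v \<in> lists X"
  shows "pres_cong X R `` {u} \<otimes>\<^bsub>presented_monoid X R\<^esub> pres_cong X R `` {v}
    = pres_cong X R `` {u @ v}"
proof -
  have "pres_cong X R `` {u' @ v'} = pres_cong X R `` {u @ v}"
    if "u' \<in> pres_cong X R `` {u}" "v' \<in> pres_cong X R `` {v}" for u' v'
    using that by (auto intro!: equiv_class_eq[OF equiv_pres_cong] pres_cong.append intro: pres_cong.sym)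
  moreover have "u \<in> pres_cong X R `` {u}" "v \<in> pres_cong X R `` {v}"
    using assms by (auto intro: pres_cong.refl)
  ultimately show ?thesis
    unfolding presented_monoid_def monoid.simps by blast
qed

lemma one_presented_monoid: "\<one>\<^bsub>presented_monoid X R\<^esub> = pres_cong X R `` {[]}"
  by (simp add: presented_monoid_def)

lemma carrier_presented_monoidE:
  assumes "A \<in> carrier (presented_monoid X R)"
  obtains u where "u \<in> lists X" "A = pres_cong X R `` {u}"
proof -
  from assms have "A \<in> lists X // pres_cong X R"
    by (simp add: presented_monoid_def)
  then show thesis
    by (rule quotientE) (rule that)
qed

section \<open>Normal forms\<close>

text \<open>The letter \<open>i\<close> moves right past every larger letter, lowering each by one,
  and stops at the first letter that is at most \<open>i\<close>. If the list is weakly decreasing,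
  so is the result. The subtraction is exact since \<open>i < k\<close>.\<close>

fun insert_gen :: "nat \<Rightarrow> nat list \<Rightarrow> nat list" where
  "insert_gen i [] = [i]"
| "insert_gen i (k # w) = (if i < k then (k - 1) # insert_gen i w else i # k # w)"

definition normal_form :: "nat list \<Rightarrow> nat list" where
  "normal_form w = foldr insert_gen w []"

text \<open>This is the defining relation of the facial monoid, read as an identity of operators on
  arbitrary lists. For a head \<open>k\<close>, the cases are \<open>k \<le> i\<close>,
  \<open>i < k \<le> j + 1\<close> and \<open>k > j + 1\<close>; only the last one needs the
  induction hypothesis.\<close>

lemma insert_gen_commute:
  "i \<le> j \<Longrightarrow> insert_gen j (insert_gen i w) = insert_gen i (insert_gen (Suc j) w)"
  by (induction w) auto

lemma foldr_insert_gen_cong: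
  "(u, v) \<in> pres_cong X facial_rels \<Longrightarrow> foldr insert_gen u w = foldr insert_gen v w"
  \<comment> \<open>The start \<open>w\<close> must vary: for concatenated words, the value of the
    right factor is the start for the left one.\<close>
  by (induction arbitrary: w rule: pres_cong.induct)
    (auto simp: facial_rels_def insert_gen_commute)

lemma trunc_cong_insert_gen:
  assumes "w \<in> lists {1..n}" "i \<in> {1..n}"
  shows "(i # w, insert_gen i w) \<in> pres_cong {1..n} (trunc_rels n)"
  using assms(1)
proof (induction w)
  case Nil
  then show ?case
    using assms(2) by (auto intro: pres_cong.refl)
next
  case (Cons k w)
  show ?case
  proof (cases "i < k")
    case True
    \<comment> \<open>This is the relation with \<open>j = k - 1\<close>: \<open>i < k\<close> gives
      \<open>i \<le> j\<close>, and \<open>k \<le> n\<close> gives exactly the truncation bound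
      \<open>j \<le> n - 1\<close>.\<close>
    then have "([k - 1, i], [i, k]) \<in> trunc_rels n"
      using assms(2) Cons.hyps unfolding trunc_rels_def
      by (intro CollectI exI[of _ i] exI[of _ "k - 1"]) auto
    then have "([k - 1, i], [i, k]) \<in> pres_cong {1..n} (trunc_rels n)"
      by (rule pres_cong.rel) (use True assms(2) Cons.hyps in auto)
    from pres_cong.append[OF pres_cong.sym[OF this] pres_cong.refl[OF Cons.hyps(2)]]
    have "(i # k # w, (k - 1) # i # w) \<in> pres_cong {1..n} (trunc_rels n)"
      by simp
    moreover have "((k - 1) # i # w, (k - 1) # insert_gen i w) \<in> pres_cong {1..n} (trunc_rels n)"
      using Cons True assms(2) by (intro pres_cong_Cons) auto
    ultimately show ?thesis
      using True by (auto intro: pres_cong.trans)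
  next
    case False
    then show ?thesis
      using Cons.hyps assms(2) by (auto intro!: pres_cong.refl)
  qed
qed

lemma trunc_cong_normal_form:
  "w \<in> lists {1..n} \<Longrightarrow> (w, normal_form w) \<in> pres_cong {1..n} (trunc_rels n)"
proof (induction w)
  case Nil
  then show ?case
    by (auto simp: normal_form_def intro: pres_cong.refl)
next
  case (Cons i w)
  then have w: "(w, normal_form w) \<in> pres_cong {1..n} (trunc_rels n)" and i: "i \<in> {1..n}"
    by simp_all
  then have "(i # w, i # normal_form w) \<in> pres_cong {1..n} (trunc_rels n)"
    by (rule pres_cong_Cons)
  \<comment> \<open>The normal form uses only letters from \<open>1\<close> to \<open>n\<close>,
    because congruent words are words over the generating set.\<close>
  moreover have "(i # normal_form w, insert_gen i (normal_form w)) \<in> pres_cong {1..n} (trunc_rels n)"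
    using pres_cong_in_lists[OF w] i by (intro trunc_cong_insert_gen) simp_all
  ultimately show ?case
    unfolding normal_form_def by (auto intro: pres_cong.trans)
qed

text \<open>From left to right this makes the canonical map well defined, by inclusion of the
  relations; from right to left it makes the map injective, by comparing normal forms.\<close>

lemma trunc_cong_iff_facial_cong:
  assumes "u \<in> lists {1..n}" "v \<in> lists {1..n}"
  shows "(u, v) \<in> pres_cong {1..n} (trunc_rels n) \<longleftrightarrow> (u, v) \<in> pres_cong {1..} facial_rels"
proof
  have "trunc_rels n \<subseteq> facial_rels"
    unfolding trunc_rels_def facial_rels_def by blast
  then have "pres_cong {1..n} (trunc_rels n) \<subseteq> pres_cong {1..} facial_rels"
    by (intro pres_cong_mono) auto
  then show "(u, v) \<in> pres_cong {1..n} (trunc_rels n) \<Longrightarrow> (u, v) \<in> pres_cong {1..} facial_rels"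
    by blast
next
  assume "(u, v) \<in> pres_cong {1..} facial_rels"
  then have "normal_form u = normal_form v"
    unfolding normal_form_def by (rule foldr_insert_gen_cong)
  with assms show "(u, v) \<in> pres_cong {1..n} (trunc_rels n)"
    by (metis pres_cong.sym pres_cong.trans trunc_cong_normal_form)
qed

section \<open>The canonical homomorphism\<close>

lemma lists_truncD: "w \<in> lists {1..n} \<Longrightarrow> w \<in> lists {1::nat..}"
  by auto

lemma foldr_facial_gen:
  assumes "w \<in> lists {1..}"
  shows "foldr (\<otimes>\<^bsub>facial_monoid\<^esub>) (map facial_gen w) \<one>\<^bsub>facial_monoid\<^esub>
    = pres_cong {1..} facial_rels `` {w}"
  using assms
proof (induction w)
  case Nil
  then show ?case
    by (simp add: facial_monoid_def one_presented_monoid)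
next
  case (Cons i w)
  then show ?case
    using mult_presented_monoid[of "[i]" "{1..}" w facial_rels]
    by (simp add: facial_monoid_def facial_gen_def pres_gen_def)
qed

text \<open>Since \<open>pres_lift\<close> applies \<open>the_elem\<close> to the set of values on a
  class, that set has to be a singleton: congruent words have one common value, and the class
  contains \<open>w\<close>.\<close>

lemma canonical_hom_class:
  assumes "w \<in> lists {1..n}"
  shows "canonical_hom n (pres_cong {1..n} (trunc_rels n) `` {w})
    = pres_cong {1..} facial_rels `` {w}"
proof -
  let ?val = "\<lambda>w. foldr (\<otimes>\<^bsub>facial_submonoid n\<^esub>) (map facial_gen w) \<one>\<^bsub>facial_submonoid n\<^esub>"
  have "?val v = pres_cong {1..} facial_rels `` {w}"
    if "(w, v) \<in> pres_cong {1..n} (trunc_rels n)" for v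
  proof -
    have v: "v \<in> lists {1..n}"
      using pres_cong_in_lists[OF that] by simp
    then have "(w, v) \<in> pres_cong {1..} facial_rels"
      using that by (simp only: trunc_cong_iff_facial_cong[OF assms])
    then have "pres_cong {1..} facial_rels `` {w} = pres_cong {1..} facial_rels `` {v}"
      by (rule equiv_class_eq[OF equiv_pres_cong])
    moreover have "?val v = pres_cong {1..} facial_rels `` {v}"
      using foldr_facial_gen[OF lists_truncD[OF v]] by (simp add: facial_submonoid_def)
    ultimately show ?thesis
      by simp
  qed
  moreover have "(w, w) \<in> pres_cong {1..n} (trunc_rels n)"
    using assms by (rule pres_cong.refl)
  ultimately have "?val ` (pres_cong {1..n} (trunc_rels n) `` {w})
      = {pres_cong {1..} facial_rels `` {w}}"
    by blast
  then show ?thesis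
    unfolding canonical_hom_def pres_lift_def by simp
qed

text \<open>The hull is the intersection of all submonoids \<open>H\<close> containing the
  generators, and each such \<open>H\<close> contains the product of generators spelled by
  \<open>w\<close>.\<close>

lemma facial_class_in_submonoid:
  assumes "w \<in> lists {1..n}"
  shows "pres_cong {1..} facial_rels `` {w} \<in> carrier (facial_submonoid n)"
proof -
  have "pres_cong {1..} facial_rels `` {w} \<in> H"
    if H: "submonoid H facial_monoid" "facial_gen ` {1..n} \<subseteq> H" for H
  proof -
    have "foldr (\<otimes>\<^bsub>facial_monoid\<^esub>) (map facial_gen w) \<one>\<^bsub>facial_monoid\<^esub> \<in> H"
      using assms
    proof (induction w)
      case Nil
      then show ?case
        using submonoid.one_closed[OF H(1)] by simp
    next
      case (Cons i w)
      then show ?case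
        using submonoid.m_closed[OF H(1)] H(2) by (simp add: image_subset_iff)
    qed
    then show ?thesis
      using foldr_facial_gen[OF lists_truncD[OF assms]] by simp
  qed
  then show ?thesis
    unfolding facial_submonoid_def hull_def by auto
qed

theorem lemma4p4:
  fixes n :: nat
  assumes "1 \<le> n"
  shows "canonical_hom n \<in> unital_hom (trunc_monoid n) (facial_submonoid n)
    \<and> (\<forall>i\<in>{1..n}. canonical_hom n (trunc_gen n i) = facial_gen i)
    \<and> inj_on (canonical_hom n) (carrier (trunc_monoid n))"
proof (intro conjI)
  let ?T = "\<lambda>w. pres_cong {1..n} (trunc_rels n) `` {w}"
  let ?F = "\<lambda>w. pres_cong {1..} facial_rels `` {w}"
  have classE: "\<exists>u\<in>lists {1..n}. A = ?T u" if "A \<in> carrier (trunc_monoid n)" for A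
    using carrier_presented_monoidE[OF that[unfolded trunc_monoid_def]] by metis
  have mult: "canonical_hom n (?T u \<otimes>\<^bsub>trunc_monoid n\<^esub> ?T v)
      = canonical_hom n (?T u) \<otimes>\<^bsub>facial_submonoid n\<^esub> canonical_hom n (?T v)"
    if "u \<in> lists {1..n}" "v \<in> lists {1..n}" for u v
    using that lists_truncD[OF that(1)] lists_truncD[OF that(2)] canonical_hom_class[of "u @ v" n]
    by (simp add: trunc_monoid_def facial_submonoid_def facial_monoid_def
        mult_presented_monoid canonical_hom_class del: One_nat_def)
  have "canonical_hom n \<in> hom (trunc_monoid n) (facial_submonoid n)"
  proof (rule homI)
    fix A
    assume "A \<in> carrier (trunc_monoid n)"
    then obtain u where u: "u \<in> lists {1..n}" "A = ?T u"
      using classE by blast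
    show "canonical_hom n A \<in> carrier (facial_submonoid n)"
      unfolding u(2) canonical_hom_class[OF u(1)] using u(1) by (rule facial_class_in_submonoid)
  next
    fix A B
    assume "A \<in> carrier (trunc_monoid n)" "B \<in> carrier (trunc_monoid n)"
    then obtain u v where u: "u \<in> lists {1..n}" "A = ?T u" and v: "v \<in> lists {1..n}" "B = ?T v"
      using classE by blast
    show "canonical_hom n (A \<otimes>\<^bsub>trunc_monoid n\<^esub> B)
        = canonical_hom n A \<otimes>\<^bsub>facial_submonoid n\<^esub> canonical_hom n B"
      unfolding u(2) v(2) using u(1) v(1) by (rule mult)
  qed
  moreover have "canonical_hom n \<one>\<^bsub>trunc_monoid n\<^esub> = \<one>\<^bsub>facial_submonoid n\<^esub>"
    using canonical_hom_class[of "[]" n]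
    by (simp add: trunc_monoid_def facial_submonoid_def facial_monoid_def one_presented_monoid)
  ultimately show "canonical_hom n \<in> unital_hom (trunc_monoid n) (facial_submonoid n)"
    unfolding unital_hom_def by blast
  show "\<forall>i\<in>{1..n}. canonical_hom n (trunc_gen n i) = facial_gen i"
    using canonical_hom_class[of "[_]" n]
    by (simp add: trunc_gen_def facial_gen_def pres_gen_def)
  show "inj_on (canonical_hom n) (carrier (trunc_monoid n))"
  proof (rule inj_onI)
    fix A B
    assume "A \<in> carrier (trunc_monoid n)" "B \<in> carrier (trunc_monoid n)"
      and eq: "canonical_hom n A = canonical_hom n B"
    then obtain u v where u: "u \<in> lists {1..n}" "A = ?T u" and v: "v \<in> lists {1..n}" "B = ?T v"
      using classE by blast
    then have "?F u = ?F v"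
      using eq by (simp add: canonical_hom_class del: One_nat_def)
    then have "(u, v) \<in> pres_cong {1..} facial_rels"
      by (simp only: pres_class_eq_iff[OF lists_truncD[OF u(1)] lists_truncD[OF v(1)]])
    \<comment> \<open>Here congruence in the facial monoid is brought back to the truncated
      presentation.\<close>
    then show "A = B"
      unfolding u(2) v(2)
      by (simp only: pres_class_eq_iff[OF u(1) v(1)] trunc_cong_iff_facial_cong[OF u(1) v(1)])
  qed
qed

end
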